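(* Let $p_0,p_1\in\Sigma_2^*$ be words such that $p_0p_1\in O_2$. Then the pair $(p_0,p_1)$ is derivable using the following rules, in which $p_0,q_0,p_1,q_1$ are variables ranging over words of $\Sigma_2^*$: (1) (axiom) $(p_0,\overline{p_0})$ is derivable whenever $p_0\in\Sigma_2^*$ and $|p_0|\le 1$; (2) if $(p_0,q_0)$ and $(p_1,q_1)$ are derivable and, moreover, $|p_0|=|q_0|=1$ or $|p_1|=|q_1|=1$, then $(p_0p_1,\,q_0q_1)$ is derivable; (3) if $(p_0,q_0)$ and $(p_1,q_1)$ are derivable, then $(p_0p_1,\,q_1q_0)$ is derivable; (4) if $(p_0,q_0)$ and $(p_1,q_1)$ are derivable, then $(p_0p_1q_0,\,q_1)$ is derivable; (5) if $(p_0,q_0)$ and $(p_1,q_1)$ are derivable, then $(p_0,\,p_1q_0q_1)$ is derivable.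
   Context: $\Sigma_2=\{a,\bar a,b,\bar b\}$ is an alphabet of four distinct letters with the involution $x\mapsto\bar x$ exchanging $a\leftrightarrow\bar a$ and $b\leftrightarrow\bar b$ ($\bar x$ is the inverse of $x$). $\Sigma_2^*$ is the set of finite words (including the empty word), $|p|$ is the length of $p$, juxtaposition is concatenation, and $\overline{p}$ is the word obtained from $p$ by inverting every letter (without reversing the order). $O_2\subseteq\Sigma_2^*$ is the set of all words in which the number of occurrences of $a$ equals that of $\bar a$ and the number of occurrences of $b$ equals that of $\bar b$. A pair of words is derivable if it is obtained by finitely many applications of the rules; i.e. the set of derivable pairs is the smallest set of pairs closed under rules (1)–(5). *)

theory Defs
  imports Main
begin

datatype letter = A | A_bar | B | B_bar

type_synonym word = "letter list"

fun inv_letter :: "letter \<Rightarrow> letter" where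
  "inv_letter A = A_bar"
| "inv_letter A_bar = A"
| "inv_letter B = B_bar"
| "inv_letter B_bar = B"

text \<open>Letterwise inversion; unlike the inverse in the free group, the order is kept.\<close>

definition bar :: "word \<Rightarrow> word" where
  "bar p = map inv_letter p"

definition O2 :: "word set" where
  "O2 = {w. count_list w A = count_list w A_bar \<and> count_list w B = count_list w B_bar}"

inductive derivable :: "word \<Rightarrow> word \<Rightarrow> bool" where
  axiom: "length p0 \<le> 1 \<Longrightarrow> derivable p0 (bar p0)"
| concat: "derivable p0 q0 \<Longrightarrow> derivable p1 q1 \<Longrightarrow>
    (length p0 = 1 \<and> length q0 = 1) \<or> (length p1 = 1 \<and> length q1 = 1) \<Longrightarrow>
    derivable (p0 @ p1) (q0 @ q1)"
| swap: "derivable p0 q0 \<Longrightarrow> derivable p1 q1 \<Longrightarrow> derivable (p0 @ p1) (q1 @ q0)"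
| wrap_left: "derivable p0 q0 \<Longrightarrow> derivable p1 q1 \<Longrightarrow> derivable (p0 @ p1 @ q0) q1"
| wrap_right: "derivable p0 q0 \<Longrightarrow> derivable p1 q1 \<Longrightarrow> derivable p0 (p1 @ q0 @ q1)"

end

theory Submission
  imports Defs "HOL-Library.Product_Plus"
begin

text \<open>
  Induct on the total length. Read \<open>p0\<close> as a lattice path \<open>\<alpha>\<close> from \<open>0\<close> to \<open>v\<close>, and \<open>p1\<close>, traversed
  backwards with inverted letters, as a second path \<open>\<delta>\<close> from \<open>0\<close> to \<open>v\<close>. Rule (3) applies when the
  two paths meet away from their common ends, rules (4) and (5) apply when one of the paths has a
  proper chord equal to \<open>v\<close>, and rule (2) applies when the first step of one path is the last step of
  the other. Suppose none applies. Then \<open>\<alpha> j - \<alpha> i - v\<close> (on the triangle \<open>i \<le> j\<close>), the same expression for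
  \<open>\<delta>\<close>, and \<open>\<alpha> i - \<delta> j\<close> (on a rectangle) vanish only at corners of their domains, so the boundary of each
  domain has total turning \<open>0\<close> once these corners are cut off. Combining the three
  equations leaves \<open>2 * (\<psi>a - \<psi>d)\<close>, where \<open>\<psi>a\<close> and \<open>\<psi>d\<close> are the turnings of \<open>\<alpha>\<close> and \<open>\<delta>\<close> as seen from \<open>0\<close>,
  expressed by the first and last steps of the paths. These steps also determine \<open>\<psi>a - \<psi>d\<close> modulo a
  full turn, hence the left side modulo two full turns, and all remaining step configurations
  violate the resulting congruence.
\<close>

section \<open>Turning numbers of lattice paths\<close>

text \<open>
  The eight sectors in counterclockwise order: half-axes get even numbers, open quadrants odd ones.
  A unit step between nonzero lattice points changes the sector by at most one, so angles
  can be measured in eighths of a turn. The value at the origin is junk.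
\<close>

definition oct :: "int \<times> int \<Rightarrow> int" where
  "oct p = (let x = fst p; y = snd p in
     if y = 0 then (if x > 0 then 0 else 4)
     else if y > 0 then (if x > 0 then 1 else if x = 0 then 2 else 3)
     else (if x < 0 then 5 else if x = 0 then 6 else 7))"

definition turn :: "int \<times> int \<Rightarrow> int \<times> int \<Rightarrow> int" where
  "turn p q = (oct q - oct p + 4) mod 8 - 4"

text \<open>For unit steps with nonzero sum, the exterior angle of a path at which step
  \<open>q\<close> follows step \<open>p\<close>, measured through the diagonal
  \<open>p + q\<close>. It appears when a corner is cut off.\<close>

definition bend :: "int \<times> int \<Rightarrow> int \<times> int \<Rightarrow> int" where
  "bend p q = turn p (p + q) + turn (p + q) q"

definition units :: "(int \<times> int) set" where
  "units = {(1, 0), (-1, 0), (0, 1), (0, -1)}"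

text \<open>Equality is included because the triangle of chords is later extended to a square by
  constant values.\<close>

definition adj :: "int \<times> int \<Rightarrow> int \<times> int \<Rightarrow> bool" where
  "adj p q \<longleftrightarrow> q - p \<in> insert 0 units"

lemma units_uminus [simp]: "- u \<in> units \<longleftrightarrow> u \<in> units"
  by (cases u) (auto simp: units_def)

lemma zero_notin_units: "0 \<notin> units"
  by (simp add: units_def zero_prod_def)

lemma units_minus_commute: "p - q \<in> units \<longleftrightarrow> q - p \<in> units"
  by (metis minus_diff_eq units_uminus)

lemma adj_self [simp]: "adj p p"
  by (simp add: adj_def)

lemma adj_commute: "adj p q \<longleftrightarrow> adj q p"
  unfolding adj_def by (metis insert_iff right_minus_eq units_minus_commute)

lemma adjI: "q - p \<in> units \<Longrightarrow> adj p q"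
  by (simp add: adj_def)

lemma adj_diff_right [simp]: "adj (p - c) (q - c) \<longleftrightarrow> adj p q"
  by (simp add: adj_def)

lemma adj_diff_left [simp]: "adj (c - p) (c - q) \<longleftrightarrow> adj p q"
proof -
  have "(c - q) - (c - p) = p - q" by simp
  then show ?thesis by (metis adj_commute adj_def)
qed

lemma turn_self [simp]: "turn p p = 0"
  by (simp add: turn_def)

lemma turn_adj:
  assumes "adj p q" "p \<noteq> 0" "q \<noteq> 0"
  shows "\<bar>turn p q\<bar> \<le> 1"
proof -
  obtain x y where p: "p = (x, y)" by (cases p)
  have "q = p + (q - p)" by simp
  then have "q \<in> {(x, y), (x + 1, y), (x - 1, y), (x, y + 1), (x, y - 1)}"
    using assms(1) unfolding adj_def units_def p by (cases q) (auto simp: zero_prod_def)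
  \<comment> \<open>The differences 7 and -7 come from crossings between sectors 7 and 0;
    \<open>turn\<close> reduces them to -1 and 1.\<close>
  with assms(2,3) have "oct q - oct p \<in> {- 1, 0, 1, 7, - 7}" unfolding p
    by (elim insertE emptyE; simp add: oct_def zero_prod_def Let_def split del: if_split;
        cases "x > 0"; cases "x = 0"; cases "y > 0"; cases "y = 0"; simp)
  then show ?thesis unfolding turn_def by auto
qed

lemma oct_uminus:
  assumes "p \<noteq> 0"
  shows "oct (- p) = oct p + 4 \<or> oct (- p) = oct p - 4"
  using assms by (cases p) (auto simp: oct_def zero_prod_def)

lemma turn_uminus:
  assumes "p \<noteq> 0" "q \<noteq> 0"
  shows "turn (- p) (- q) = turn p q"
proof -
  have shift: "(c + 8 + 4) mod 8 = (c + 4) mod 8" for c :: int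
    using mod_add_self2[of "c + 4" 8] by (simp only: add.assoc add.commute[of 8 4])
  have shift': "(c - 8 + 4) mod 8 = (c + 4) mod 8" for c :: int
    using shift[of "c - 8"] by (simp only: diff_add_cancel)
  consider "oct (- q) - oct (- p) = oct q - oct p" | "oct (- q) - oct (- p) = oct q - oct p + 8"
    | "oct (- q) - oct (- p) = oct q - oct p - 8"
    using oct_uminus[OF assms(1)] oct_uminus[OF assms(2)] by linarith
  then show ?thesis by cases (simp_all only: turn_def shift shift')
qed

lemma bend_self: "bend p p = 0"
proof -
  have "oct (p + p) = oct p" by (cases p) (auto simp: oct_def)
  then show ?thesis by (simp add: bend_def turn_def)
qed

section \<open>Total turning along paths and around rectangles\<close>

lemma turn_cong: "\<exists>k. turn p q = oct q - oct p + 8 * k"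
proof
  show "turn p q = oct q - oct p + 8 * (- ((oct q - oct p + 4) div 8))"
    using mult_div_mod_eq[of 8 "oct q - oct p + 4"] unfolding turn_def by linarith
qed

text \<open>Both sides agree modulo 8 and differ by at most 4.\<close>

lemma turn_square:
  assumes "\<bar>turn p q\<bar> \<le> 1" "\<bar>turn q r\<bar> \<le> 1" "\<bar>turn p s\<bar> \<le> 1" "\<bar>turn s r\<bar> \<le> 1"
  shows "turn p q + turn q r = turn p s + turn s r"
proof -
  obtain a where a: "turn p q = oct q - oct p + 8 * a" using turn_cong by blast
  obtain b where b: "turn q r = oct r - oct q + 8 * b" using turn_cong by blast
  obtain c where c: "turn p s = oct s - oct p + 8 * c" using turn_cong by blast
  obtain d where d: "turn s r = oct r - oct s + 8 * d" using turn_cong by blast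
  have eq: "turn p q + turn q r - (turn p s + turn s r) = 8 * (a + b - c - d)"
    unfolding a b c d by (simp add: algebra_simps)
  have "\<bar>turn p q + turn q r - (turn p s + turn s r)\<bar> \<le> 4" using assms by linarith
  moreover have "x = 0" if "\<bar>8 * x\<bar> \<le> 4" for x :: int using that by linarith
  ultimately have "a + b - c - d = 0" unfolding eq by blast
  then show ?thesis using eq by simp
qed

text \<open>Around each unit square the turning is zero by \<open>turn_square\<close>; summing over
  all squares cancels the inner edges and leaves the boundary.\<close>

lemma turn_rectangle:
  assumes "\<And>i j. i < m \<Longrightarrow> j \<le> n \<Longrightarrow> \<bar>turn (F i j) (F (Suc i) j)\<bar> \<le> 1"
    and "\<And>i j. i \<le> m \<Longrightarrow> j < n \<Longrightarrow> \<bar>turn (F i j) (F i (Suc j))\<bar> \<le> 1"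
  shows "(\<Sum>i<m. turn (F i 0) (F (Suc i) 0)) + (\<Sum>j<n. turn (F m j) (F m (Suc j)))
       = (\<Sum>j<n. turn (F 0 j) (F 0 (Suc j))) + (\<Sum>i<m. turn (F i n) (F (Suc i) n))"
  using assms
proof (induction m)
  case 0
  then show ?case by simp
next
  case (Suc m)
  note hor = Suc.prems(1) and ver = Suc.prems(2)
  \<comment> \<open>The crossing edge of the last strip is pushed from height 0 to height
    \<open>k\<close>, one square at a time.\<close>
  have strip: "(\<Sum>j<k. turn (F m j) (F m (Suc j))) + turn (F m k) (F (Suc m) k)
      = turn (F m 0) (F (Suc m) 0) + (\<Sum>j<k. turn (F (Suc m) j) (F (Suc m) (Suc j)))"
    if "k \<le> n" for k
    using that
  proof (induction k)
    case 0
    then show ?case by simp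
  next
    case (Suc k)
    have "turn (F m k) (F m (Suc k)) + turn (F m (Suc k)) (F (Suc m) (Suc k))
        = turn (F m k) (F (Suc m) k) + turn (F (Suc m) k) (F (Suc m) (Suc k))"
      by (rule turn_square) (use Suc.prems in \<open>auto intro: hor ver\<close>)
    with Suc show ?case by simp
  qed
  show ?case using strip[of n] Suc by simp
qed

text \<open>Octant differences telescope, and every reduction modulo 8 contributes full turns
  only.\<close>

lemma turn_sum_cong:
  "\<exists>k. (\<Sum>i<n. turn (f i) (f (Suc i))) = oct (f n) - oct (f 0) + 8 * k"
proof (induction n)
  case 0
  then show ?case by (simp add: exI[of _ 0])
next
  case (Suc n)
  then obtain k where "(\<Sum>i<n. turn (f i) (f (Suc i))) = oct (f n) - oct (f 0) + 8 * k" by blast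
  moreover obtain l where "turn (f n) (f (Suc n)) = oct (f (Suc n)) - oct (f n) + 8 * l"
    using turn_cong by blast
  ultimately show ?case by (intro exI[of _ "k + l"]) simp
qed


section \<open>Boundary equations for chords and for pairs of paths\<close>

text \<open>On the triangle of chords, \<open>al j - al i - al (Suc k)\<close> is constant along the
  diagonal. The other two sides show the path as seen from its end and, up to sign, from its start;
  cutting off the corner between them gives the bend.\<close>

lemma chord_turning:
  assumes steps: "\<And>i. i < Suc k \<Longrightarrow> al (Suc i) - al i \<in> units"
    and start: "al 0 = 0"
    and chord: "\<And>i j. i \<le> j \<Longrightarrow> j \<le> Suc k \<Longrightarrow> al j - al i = al (Suc k) \<Longrightarrow> i = 0 \<and> j = Suc k"
  shows "(\<Sum>j<k. turn (al j - al (Suc k)) (al (Suc j) - al (Suc k)))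
    + bend (al (Suc k) - al k) (al 1) + (\<Sum>i<k. turn (al (Suc i)) (al (Suc (Suc i)))) = 0"
proof (cases k)
  \<comment> \<open>For a single step the diagonal neighbour of the corner would fall below the
    diagonal.\<close>
  case 0
  then show ?thesis by (simp add: start bend_self)
next
  case (Suc k')
  define v where "v = al (Suc k)"
  have v: "v \<noteq> 0" using chord[of 0 0] by (auto simp: v_def)
  \<comment> \<open>The zero at the corner \<open>(0, Suc k)\<close> is replaced by the value of the diagonal neighbour,
    and the triangle is extended to a square by the constant \<open>- v\<close>.\<close>
  define F where "F = (\<lambda>i j. if i = 0 \<and> j = Suc k then al k - al 1 - v else al (max i j) - al i - v)"
  have F_corner: "F 0 (Suc k) = al k - al 1 - v" by (simp add: F_def)
  have F_upper: "F i j = al j - al i - v" if "i \<le> j" "\<not> (i = 0 \<and> j = Suc k)" for i j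
    using that unfolding F_def by (simp only: if_False max_absorb2)
  have F_lower: "F i j = - v" if "j \<le> i" for i j
    using that by (auto simp: F_def max_absorb1)
  have step: "adj (al i) (al (Suc i))" if "i < Suc k" for i
    using steps[OF that] by (rule adjI)
  have "1 \<le> k" using Suc by simp
  have F_nz: "F i j \<noteq> 0" if "j \<le> Suc k" for i j
  proof -
    consider "i = 0" "j = Suc k" | "i \<le> j" "\<not> (i = 0 \<and> j = Suc k)" | "j \<le> i"
      using nat_le_linear by blast
    then show ?thesis
    proof cases
      case 1
      have "al k - al 1 \<noteq> v" using chord[OF \<open>1 \<le> k\<close>] unfolding v_def by fastforce
      then show ?thesis by (simp add: 1 F_corner)
    next
      case 2
      have "al j - al i \<noteq> v" using chord[OF 2(1) that] 2(2) unfolding v_def by blast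
      then show ?thesis by (simp only: F_upper[OF 2] right_minus_eq not_False_eq_True)
    next
      case 3
      then show ?thesis using v by (simp add: F_lower)
    qed
  qed
  have hor: "adj (F i j) (F (Suc i) j)" if "i < Suc k" for i j
  proof -
    consider "i = 0" "j = Suc k" | "i < j" "\<not> (i = 0 \<and> j = Suc k)" | "j \<le> i"
      using not_less by blast
    then show ?thesis
    proof cases
      case 1
      have "F 1 (Suc k) = al (Suc k) - al 1 - v" by (rule F_upper) simp_all
      then show ?thesis using step[of k] by (simp add: 1 F_corner)
    next
      case 2
      have eq: "F i j = al j - al i - v" "F (Suc i) j = al j - al (Suc i) - v"
        by (rule F_upper; use 2 in simp)+
      show ?thesis unfolding eq using step[OF that] by simp
    next
      case 3
      then show ?thesis by (simp add: F_lower)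
    qed
  qed
  have ver: "adj (F i j) (F i (Suc j))" if "j < Suc k" for i j
  proof -
    consider "i = 0" "j = k" | "i \<le> j" "\<not> (i = 0 \<and> j = k)" | "j < i"
      using not_less by blast
    then show ?thesis
    proof cases
      case 1
      have eq: "F 0 k = al k - al 0 - v" by (rule F_upper) simp_all
      show ?thesis unfolding 1 eq F_corner using step[of 0] by simp
    next
      case 2
      have eq: "F i j = al j - al i - v" "F i (Suc j) = al (Suc j) - al i - v"
        by (rule F_upper; use 2 that in simp)+
      show ?thesis unfolding eq using step[OF that] by simp
    next
      case 3
      then show ?thesis by (simp add: F_lower)
    qed
  qed
  have al_nz: "al (Suc i) \<noteq> 0" if "i \<le> k" for i
    using chord[of "Suc i" "Suc k"] that by auto
  have "(\<Sum>i<Suc k. turn (F i 0) (F (Suc i) 0)) + (\<Sum>j<Suc k. turn (F (Suc k) j) (F (Suc k) (Suc j)))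
      = (\<Sum>j<Suc k. turn (F 0 j) (F 0 (Suc j))) + (\<Sum>i<Suc k. turn (F i (Suc k)) (F (Suc i) (Suc k)))"
    by (rule turn_rectangle) (intro turn_adj F_nz hor ver; simp)+
  moreover have "(\<Sum>i<Suc k. turn (F i 0) (F (Suc i) 0)) = 0"
    by (rule sum.neutral) (auto simp: F_lower)
  moreover have "(\<Sum>j<Suc k. turn (F (Suc k) j) (F (Suc k) (Suc j))) = 0"
    by (rule sum.neutral) (auto simp: F_lower)
  moreover have "(\<Sum>j<Suc k. turn (F 0 j) (F 0 (Suc j)))
      = (\<Sum>j<k. turn (al j - v) (al (Suc j) - v)) + turn (al k - v) (al k - al 1 - v)"
    by (simp add: F_upper F_corner start)
  moreover have "(\<Sum>i<Suc k. turn (F i (Suc k)) (F (Suc i) (Suc k)))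
      = turn (al k - al 1 - v) (- al 1) + (\<Sum>i<k. turn (al (Suc i)) (al (Suc (Suc i))))"
  proof -
    have "F (Suc i) (Suc k) = - al (Suc i)" if "i \<le> k" for i
      using that F_upper[of "Suc i" "Suc k"] by (simp add: v_def)
    moreover note F_corner
    ultimately show ?thesis
      by (simp add: sum.lessThan_Suc_shift turn_uminus al_nz del: sum.lessThan_Suc)
  qed
  \<comment> \<open>The two turns at the cut corner are, after negating all vectors, those from the
    last step through the diagonal to the first step.\<close>
  moreover have "turn (al k - v) (al k - al 1 - v) + turn (al k - al 1 - v) (- al 1)
      = bend (v - al k) (al 1)"
  proof -
    have eq: "al k - v = - (v - al k)" "al k - al 1 - v = - (v - al k + al 1)" by simp_all
    have "al k \<noteq> v" using chord[of 0 k] start unfolding v_def by fastforce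
    moreover have "al k - al 1 \<noteq> v" using chord[OF \<open>1 \<le> k\<close>] unfolding v_def by fastforce
    moreover have "al 1 \<noteq> 0" using al_nz[of 0] by simp
    ultimately have nz: "v - al k \<noteq> 0" "v - al k + al 1 \<noteq> 0" "al 1 \<noteq> 0"
      by (auto simp: prod_eq_iff)
    show ?thesis unfolding bend_def eq turn_uminus[OF nz(1,2)] turn_uminus[OF nz(2,3)] ..
  qed
  ultimately show ?thesis by (simp add: v_def)
qed

text \<open>The four sides of the rectangle for \<open>al i - de j\<close> show each path from
  \<open>0\<close> and from \<open>v\<close>, up to sign; the remaining terms come from the two cut
  corners.\<close>

lemma pair_turning:
  fixes al de :: "nat \<Rightarrow> int \<times> int"
  assumes al_steps: "\<And>i. i < Suc k \<Longrightarrow> al (Suc i) - al i \<in> units"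
    and de_steps: "\<And>i. i < Suc l \<Longrightarrow> de (Suc i) - de i \<in> units"
    and al_0: "al 0 = 0" and de_0: "de 0 = 0" and al_v: "al (Suc k) = v" and de_v: "de (Suc l) = v"
    and disjoint: "\<And>i j. i \<le> Suc k \<Longrightarrow> j \<le> Suc l \<Longrightarrow> al i = de j
      \<Longrightarrow> i = 0 \<and> j = 0 \<or> i = Suc k \<and> j = Suc l"
    and long: "0 < k + l"
  shows "turn (al 1 - de 1) (al 1) + (\<Sum>i<k. turn (al (Suc i)) (al (Suc (Suc i))))
      + (\<Sum>j<l. turn (de j - v) (de (Suc j) - v)) + turn (v - de l) (al k - de l)
    = turn (al 1 - de 1) (- de 1) + (\<Sum>j<l. turn (de (Suc j)) (de (Suc (Suc j))))
      + (\<Sum>i<k. turn (al i - v) (al (Suc i) - v)) + turn (al k - v) (al k - de l)"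
proof -
  \<comment> \<open>Both zeros, at opposite corners, are replaced by the values of the diagonal neighbours.\<close>
  define G where "G = (\<lambda>i j. if i = 0 \<and> j = 0 then al 1 - de 1
    else if i = Suc k \<and> j = Suc l then al k - de l else al i - de j)"
  \<comment> \<open>For \<open>k = l = 0\<close> each zero corner would be the diagonal neighbour of
    the other; \<open>long\<close> excludes this.\<close>
  have G_nz: "G i j \<noteq> 0" if "i \<le> Suc k" "j \<le> Suc l" for i j
    using that disjoint[of i j] disjoint[of 1 1] disjoint[of k l] long
    by (auto simp: G_def)
  have G_start: "G 0 0 = al 1 - de 1" and G_end: "G (Suc k) (Suc l) = al k - de l"
    by (simp_all add: G_def)
  have G_mid: "G i j = al i - de j" if "\<not> (i = 0 \<and> j = 0)" "\<not> (i = Suc k \<and> j = Suc l)" for i j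
    using that unfolding G_def by (simp only: if_False)
  have al_step: "adj (al i) (al (Suc i))" if "i < Suc k" for i
    using al_steps[OF that] by (rule adjI)
  have de_step: "adj (de j) (de (Suc j))" "adj (de (Suc j)) (de j)" if "j < Suc l" for j
    using adjI[OF de_steps[OF that]] by (simp_all add: adj_commute)
  have hor: "adj (G i j) (G (Suc i) j)" if "i < Suc k" for i j
  proof -
    consider "i = 0" "j = 0" | "i = k" "j = Suc l" | "\<not> (i = 0 \<and> j = 0)" "\<not> (i = k \<and> j = Suc l)"
      by blast
    then show ?thesis
    proof cases
      case 1
      have eq: "G (Suc 0) 0 = al 1 - de 0" using G_mid[of 1 0] by simp
      show ?thesis unfolding 1 eq G_start using de_step[of 0] by simp
    next
      case 2
      have eq: "G k (Suc l) = al k - de (Suc l)" by (rule G_mid) simp_all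
      show ?thesis unfolding 2 eq G_end using de_step[of l] by simp
    next
      case 3
      have eq: "G i j = al i - de j" "G (Suc i) j = al (Suc i) - de j"
        by (rule G_mid; use 3 that in simp)+
      show ?thesis unfolding eq using al_step[OF that] by simp
    qed
  qed
  have ver: "adj (G i j) (G i (Suc j))" if "j < Suc l" for i j
  proof -
    consider "i = 0" "j = 0" | "i = Suc k" "j = l" | "\<not> (i = 0 \<and> j = 0)" "\<not> (i = Suc k \<and> j = l)"
      by blast
    then show ?thesis
    proof cases
      case 1
      have eq: "G 0 (Suc 0) = al 0 - de 1" using G_mid[of 0 1] by simp
      show ?thesis unfolding 1 eq G_start using al_step[of 0] by (simp add: adj_commute)
    next
      case 2
      have eq: "G (Suc k) l = al (Suc k) - de l" by (rule G_mid) simp_all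
      show ?thesis unfolding 2 eq G_end using al_step[of k] by (simp add: adj_commute)
    next
      case 3
      have eq: "G i j = al i - de j" "G i (Suc j) = al i - de (Suc j)"
        by (rule G_mid; use 3 that in simp)+
      show ?thesis unfolding eq using de_step[OF that] by simp
    qed
  qed
  have de_nz: "de (Suc j) \<noteq> 0" if "j \<le> l" for j
    using disjoint[of 0 "Suc j"] that al_0 by auto
  have de_nv: "de j - v \<noteq> 0" if "j \<le> l" for j
    using disjoint[of "Suc k" j] that al_v by auto
  have "(\<Sum>i<Suc k. turn (G i 0) (G (Suc i) 0)) + (\<Sum>j<Suc l. turn (G (Suc k) j) (G (Suc k) (Suc j)))
      = (\<Sum>j<Suc l. turn (G 0 j) (G 0 (Suc j))) + (\<Sum>i<Suc k. turn (G i (Suc l)) (G (Suc i) (Suc l)))"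
    by (rule turn_rectangle) (intro turn_adj G_nz hor ver; simp)+
  moreover have "(\<Sum>i<Suc k. turn (G i 0) (G (Suc i) 0))
      = turn (al 1 - de 1) (al 1) + (\<Sum>i<k. turn (al (Suc i)) (al (Suc (Suc i))))"
    by (simp add: G_def de_0 sum.lessThan_Suc_shift del: sum.lessThan_Suc)
  moreover have "(\<Sum>j<Suc l. turn (G (Suc k) j) (G (Suc k) (Suc j)))
      = (\<Sum>j<l. turn (de j - v) (de (Suc j) - v)) + turn (v - de l) (al k - de l)"
  proof -
    have "turn (v - de j) (v - de (Suc j)) = turn (de j - v) (de (Suc j) - v)" if "j < l" for j
      using turn_uminus[of "de j - v" "de (Suc j) - v"] de_nv[of j] de_nv[of "Suc j"] that by simp
    then show ?thesis by (simp add: G_def al_v)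
  qed
  moreover have "(\<Sum>j<Suc l. turn (G 0 j) (G 0 (Suc j)))
      = turn (al 1 - de 1) (- de 1) + (\<Sum>j<l. turn (de (Suc j)) (de (Suc (Suc j))))"
    by (simp add: G_def al_0 sum.lessThan_Suc_shift turn_uminus de_nz del: sum.lessThan_Suc)
  moreover have "(\<Sum>i<Suc k. turn (G i (Suc l)) (G (Suc i) (Suc l)))
      = (\<Sum>i<k. turn (al i - v) (al (Suc i) - v)) + turn (al k - v) (al k - de l)"
    by (simp add: G_def de_v)
  ultimately show ?thesis by linarith
qed

section \<open>Contradiction modulo two full turns\<close>

text \<open>
  Modulo 16 is two full turns: the turnings themselves are known only modulo 8, but
  they enter the combined boundary equation twice.
\<close>

lemma units_check:
  "\<forall>a\<in>units. \<forall>a'\<in>units. \<forall>d\<in>units. \<forall>d'\<in>units.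
     a \<noteq> d \<longrightarrow> a' \<noteq> d' \<longrightarrow> a + a' \<noteq> 0 \<longrightarrow> d + d' \<noteq> 0 \<longrightarrow> a \<noteq> d' \<longrightarrow> a' \<noteq> d \<longrightarrow>
     (turn (a - d) (- d) - turn (a - d) a + turn (- a') (d' - a') - turn d' (d' - a')
       - bend a' a + bend d' d - 2 * (oct d - oct a)) mod 16 \<noteq> 0"
  unfolding units_def by code_simp

text \<open>If both alternatives fail, the first and last steps satisfy the inequalities of
  \<open>units_check\<close>, while the three boundary equations yield the congruence forbidden
  there.\<close>

lemma lattice_paths_turning:
  fixes al de :: "nat \<Rightarrow> int \<times> int"
  assumes al_steps: "\<And>i. i < m \<Longrightarrow> al (Suc i) - al i \<in> units"
    and de_steps: "\<And>i. i < n \<Longrightarrow> de (Suc i) - de i \<in> units"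
    and al_0: "al 0 = 0" and de_0: "de 0 = 0" and ends: "al m = de n"
    and "0 < m" "0 < n" "2 < m + n"
    and al_chord: "\<And>i j. i \<le> j \<Longrightarrow> j \<le> m \<Longrightarrow> al j - al i = al m \<Longrightarrow> i = 0 \<and> j = m"
    and de_chord: "\<And>i j. i \<le> j \<Longrightarrow> j \<le> n \<Longrightarrow> de j - de i = de n \<Longrightarrow> i = 0 \<and> j = n"
    and disjoint: "\<And>i j. i \<le> m \<Longrightarrow> j \<le> n \<Longrightarrow> al i = de j
      \<Longrightarrow> i = 0 \<and> j = 0 \<or> i = m \<and> j = n"
  shows "al 1 = de n - de (n - 1) \<or> al m - al (m - 1) = de 1"
proof (rule ccontr)
  assume neq: "\<not> ?thesis"
  obtain k l where m: "m = Suc k" and n: "n = Suc l"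
    using \<open>0 < m\<close> \<open>0 < n\<close> by (metis gr0_implies_Suc)
  define v where "v = al m"
  define \<psi>a where "\<psi>a = (\<Sum>i<k. turn (al (Suc i)) (al (Suc (Suc i))))"
  define \<psi>d where "\<psi>d = (\<Sum>i<l. turn (de (Suc i)) (de (Suc (Suc i))))"
  define \<phi>a where "\<phi>a = (\<Sum>i<k. turn (al i - v) (al (Suc i) - v))"
  define \<phi>d where "\<phi>d = (\<Sum>i<l. turn (de i - v) (de (Suc i) - v))"
  define a d a' d' where "a = al 1" and "d = de 1" and "a' = v - al k" and "d' = v - de l"
  note ad = a_def d_def a'_def d'_def
  have al_v: "al (Suc k) = v" and de_v: "de (Suc l) = v" using ends by (simp_all add: v_def m n)
  have bend_a: "\<phi>a + bend a' a + \<psi>a = 0"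
    using chord_turning[of k al] al_steps al_0 al_chord unfolding m \<phi>a_def \<psi>a_def ad al_v by blast
  have bend_d: "\<phi>d + bend d' d + \<psi>d = 0"
    using chord_turning[of l de] de_steps de_0 de_chord unfolding n \<phi>d_def \<psi>d_def ad de_v by blast
  have "turn (a - d) a + \<psi>a + \<phi>d + turn d' (d' - a') = turn (a - d) (- d) + \<psi>d + \<phi>a + turn (- a') (d' - a')"
    using pair_turning[of k al l de v] al_steps de_steps al_0 de_0 al_v de_v disjoint \<open>2 < m + n\<close>
    unfolding m n \<phi>a_def \<psi>a_def \<phi>d_def \<psi>d_def ad by simp
  moreover obtain r where "\<psi>a = oct v - oct a + 8 * r"
    using turn_sum_cong[where f = "\<lambda>i. al (Suc i)" and n = k] by (auto simp: \<psi>a_def a_def al_v)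
  moreover obtain s where "\<psi>d = oct v - oct d + 8 * s"
    using turn_sum_cong[where f = "\<lambda>i. de (Suc i)" and n = l] by (auto simp: \<psi>d_def d_def de_v)
  \<comment> \<open>Eliminating \<open>\<phi>a\<close> and \<open>\<phi>d\<close> leaves
    \<open>2 * (\<psi>a - \<psi>d)\<close>, in which \<open>oct v\<close> cancels.\<close>
  ultimately have "turn (a - d) (- d) - turn (a - d) a + turn (- a') (d' - a') - turn d' (d' - a')
       - bend a' a + bend d' d - 2 * (oct d - oct a) = 16 * (r - s)"
    using bend_a bend_d by simp
  then have eq: "(turn (a - d) (- d) - turn (a - d) a + turn (- a') (d' - a') - turn d' (d' - a')
       - bend a' a + bend d' d - 2 * (oct d - oct a)) mod 16 = 0" by simp
  have in_units: "a \<in> units" "d \<in> units" "a' \<in> units" "d' \<in> units"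
    using al_steps[of 0] al_steps[of k] de_steps[of 0] de_steps[of l] al_0 de_0 al_v de_v
    by (simp_all add: ad m n)
  have "a \<noteq> d" "a' \<noteq> d'"
    using disjoint[of 1 1] disjoint[of k l] \<open>2 < m + n\<close> by (auto simp: ad m n)
  \<comment> \<open>If the first and last steps cancel, the path without them is a proper chord
    equal to \<open>v\<close>, unless there is only one step; that step would then be its own
    negative.\<close>
  have "a + a' \<noteq> 0"
  proof
    assume "a + a' = 0"
    then have "al k - al 1 = v" by (simp add: ad algebra_simps add_eq_0_iff)
    with al_chord[of 1 k] al_v have "k = 0" by (cases k) (auto simp: m)
    with \<open>a + a' = 0\<close> have "v = - v" using al_v al_0 by (simp add: ad add_eq_0_iff)
    then show False using in_units(1) \<open>k = 0\<close> al_v by (cases v) (auto simp: ad units_def)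
  qed
  have "d + d' \<noteq> 0"
  proof
    assume "d + d' = 0"
    then have "de l - de 1 = v" by (simp add: ad algebra_simps add_eq_0_iff)
    with de_chord[of 1 l] de_v have "l = 0" by (cases l) (auto simp: n)
    with \<open>d + d' = 0\<close> have "v = - v" using de_v de_0 by (simp add: ad add_eq_0_iff)
    then show False using in_units(2) \<open>l = 0\<close> de_v by (cases v) (auto simp: ad units_def)
  qed
  have "a \<noteq> d'" "a' \<noteq> d" using neq by (simp_all add: ad m n al_v de_v)
  from units_check[rule_format, OF in_units(1,3,2,4) \<open>a \<noteq> d\<close> \<open>a' \<noteq> d'\<close>
      \<open>a + a' \<noteq> 0\<close> \<open>d + d' \<noteq> 0\<close> this] eq
  show False by (rule notE)
qed


section \<open>Words as lattice paths\<close>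

fun vec :: "letter \<Rightarrow> int \<times> int" where
  "vec A = (1, 0)"
| "vec A_bar = (-1, 0)"
| "vec B = (0, 1)"
| "vec B_bar = (0, -1)"

definition disp :: "word \<Rightarrow> int \<times> int" where
  "disp w = sum_list (map vec w)"

lemma disp_simps [simp]:
  "disp [] = 0" "disp (x # w) = vec x + disp w" "disp (u @ w) = disp u + disp w"
  by (simp_all add: disp_def)

lemma vec_in_units [simp]: "vec x \<in> units"
  by (cases x) (simp_all add: units_def)

lemma vec_eq_uminus: "vec x = - vec y \<Longrightarrow> y = inv_letter x"
  by (cases x; cases y) simp_all

lemma disp_count:
  "disp w = (int (count_list w A) - int (count_list w A_bar), int (count_list w B) - int (count_list w B_bar))"
proof (induction w)
  case Nil
  then show ?case by (simp add: zero_prod_def)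
next
  case (Cons x w)
  then show ?case by (cases x) simp_all
qed

lemma O2_iff_disp: "w \<in> O2 \<longleftrightarrow> disp w = 0"
  by (simp add: O2_def disp_count zero_prod_def)

lemma disp_take_Suc: "i < length w \<Longrightarrow> disp (take (Suc i) w) - disp (take i w) = vec (w ! i)"
  by (simp add: take_Suc_conv_app_nth)

lemma disp_drop_Suc: "i < length w \<Longrightarrow> disp (drop i w) - disp (drop (Suc i) w) = vec (w ! i)"
  by (simp flip: Cons_nth_drop_Suc)

lemma take_mid_drop: "i \<le> j \<Longrightarrow> take i w @ take (j - i) (drop i w) @ drop j w = w"
  by (metis append.assoc append_take_drop_id le_add_diff_inverse take_add)

section \<open>Derivability of pairs with total displacement zero\<close>

lemma derivable_letters: "derivable [x] [inv_letter x]"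
  using axiom[of "[x]"] by (simp add: bar_def)

text \<open>If the pair is not derivable, no split into shorter pairs of displacement zero is
  possible: \<open>left\<close>, \<open>right\<close> and \<open>cross\<close> record this for
  \<open>wrap_left\<close>, \<open>wrap_right\<close> and \<open>swap\<close>. The path lemma then
  provides a split for \<open>concat\<close>.\<close>

lemma derivable_step:
  assumes IH: "\<And>p q. length p + length q < length p0 + length p1 \<Longrightarrow> disp p + disp q = 0 \<Longrightarrow> derivable p q"
    and ne: "p0 \<noteq> []" "p1 \<noteq> []" and zero: "disp p0 + disp p1 = 0"
  shows "derivable p0 p1"
proof (rule ccontr)
  assume not: "\<not> derivable p0 p1"
  define m n where "m = length p0" and "n = length p1"
  have pos: "0 < m" "0 < n" using ne by (simp_all add: m_def n_def)
  have left: "x = [] \<and> z = []" if "p0 = x @ y @ z" "disp y = disp p0" for x y z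
  proof (rule ccontr)
    assume nonempty: "\<not> ?thesis"
    have zeros: "disp x + disp z = 0" "disp y + disp p1 = 0"
      using that zero by (simp_all add: prod_eq_iff)
    have "derivable x z" by (rule IH[OF _ zeros(1)]) (use nonempty ne that(1) in auto)
    moreover have "derivable y p1" by (rule IH[OF _ zeros(2)]) (use nonempty ne that(1) in auto)
    ultimately show False using wrap_left not that(1,2) by metis
  qed
  have right: "x = [] \<and> z = []" if "p1 = x @ y @ z" "disp y = disp p1" for x y z
  proof (rule ccontr)
    assume nonempty: "\<not> ?thesis"
    have zeros: "disp p0 + disp y = 0" "disp x + disp z = 0"
      using that zero by (simp_all add: prod_eq_iff)
    have "derivable p0 y" by (rule IH[OF _ zeros(1)]) (use nonempty ne that(1) in auto)
    moreover have "derivable x z" by (rule IH[OF _ zeros(2)]) (use nonempty ne that(1) in auto)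
    ultimately show False using wrap_right not that(1,2) by metis
  qed
  have cross: "x = [] \<and> w = [] \<or> y = [] \<and> z = []"
    if "p0 = x @ y" "p1 = z @ w" "disp x + disp w = 0" for x y z w
  proof (rule ccontr)
    assume nonempty: "\<not> ?thesis"
    have "disp y + disp z = 0"
      using zero that by (simp add: prod_eq_iff)
    have "derivable x w" by (rule IH[OF _ that(3)]) (use nonempty that(1,2) in auto)
    moreover have "derivable y z" by (rule IH[OF _ \<open>disp y + disp z = 0\<close>]) (use nonempty that(1,2) in auto)
    ultimately show False using swap not that(1,2) by metis
  qed
  have two: "2 < m + n"
  proof (rule ccontr)
    assume "\<not> ?thesis"
    then have "m = 1" "n = 1" using pos by simp_all
    then obtain x y where xy: "p0 = [x]" "p1 = [y]"
      by (metis m_def n_def One_nat_def length_0_conv length_Suc_conv)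
    then have "y = inv_letter x" using zero by (intro vec_eq_uminus) (simp add: eq_neg_iff_add_eq_0)
    then show False using not derivable_letters xy by simp
  qed
  define al where "al = (\<lambda>i. disp (take i p0))"
  \<comment> \<open>The sign turns a prefix of \<open>p0\<close> and a suffix of \<open>p1\<close>
    with opposite displacements into a common point of the two paths.\<close>
  define de where "de = (\<lambda>j. - disp (drop (n - j) p1))"
  have al_step: "al (Suc i) - al i = vec (p0 ! i)" if "i < m" for i
    using that by (simp only: al_def m_def disp_take_Suc)
  have de_step: "de (Suc j) - de j = - vec (p1 ! (n - Suc j))" if "j < n" for j
  proof -
    have "disp (drop (n - Suc j) p1) - disp (drop (n - j) p1) = vec (p1 ! (n - Suc j))"
      using that disp_drop_Suc[of "n - Suc j" p1] by (simp add: n_def Suc_diff_Suc)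
    then show ?thesis by (simp add: de_def prod_eq_iff)
  qed
  have ends: "al m = de n" using zero by (simp add: al_def de_def m_def n_def eq_neg_iff_add_eq_0)
  have "al 1 = de n - de (n - 1) \<or> al m - al (m - 1) = de 1"
  proof (rule lattice_paths_turning[where al = al and de = de and m = m and n = n, OF _ _ _ _ ends pos two])
    show "al (Suc i) - al i \<in> units" if "i < m" for i using that by (simp add: al_step)
    show "de (Suc i) - de i \<in> units" if "i < n" for i using that by (simp add: de_step)
    show "al 0 = 0" "de 0 = 0" by (simp_all add: al_def de_def n_def)
    show "i = 0 \<and> j = m" if "i \<le> j" "j \<le> m" "al j - al i = al m" for i j
    proof -
      have "disp (take j p0) = disp (take i p0) + disp (take (j - i) (drop i p0))"
        using \<open>i \<le> j\<close> by (metis disp_simps(3) le_add_diff_inverse take_add)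
      then have "disp (take (j - i) (drop i p0)) = disp p0"
        using that by (simp add: al_def m_def)
      from left[OF take_mid_drop[OF \<open>i \<le> j\<close>, symmetric] this] show ?thesis
        using that ne by (simp add: m_def)
    qed
    \<comment> \<open>Since \<open>de\<close> runs through \<open>p1\<close> from its end, the chord
      from \<open>i\<close> to \<open>j\<close> belongs to the factor between positions
      \<open>n - j\<close> and \<open>n - i\<close>.\<close>
    show "i = 0 \<and> j = n" if "i \<le> j" "j \<le> n" "de j - de i = de n" for i j
    proof -
      have le: "n - j \<le> n - i" using that by simp
      have "disp (take (n - i) p1) = disp (take (n - j) p1) + disp (take (n - i - (n - j)) (drop (n - j) p1))"
        using le by (metis disp_simps(3) le_add_diff_inverse take_add)
      moreover have "disp (take k p1) + disp (drop k p1) = disp p1" for k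
        by (metis append_take_drop_id disp_simps(3))
      from this[of "n - i"] this[of "n - j"]
      have "disp (take (n - i) p1) - disp (take (n - j) p1) = disp (drop (n - j) p1) - disp (drop (n - i) p1)"
        by (simp add: prod_eq_iff)
      moreover have "disp (drop (n - j) p1) - disp (drop (n - i) p1) = disp p1"
        using that by (simp add: de_def algebra_simps)
      ultimately have "disp (take (n - i - (n - j)) (drop (n - j) p1)) = disp p1" by simp
      from right[OF take_mid_drop[OF le, symmetric] this] show ?thesis
        using that ne by (auto simp: n_def)
    qed
    show "i = 0 \<and> j = 0 \<or> i = m \<and> j = n" if "i \<le> m" "j \<le> n" "al i = de j" for i j
      using cross[of "take i p0" "drop i p0" "take (n - j) p1" "drop (n - j) p1"] that ne
      by (auto simp: al_def de_def m_def n_def)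
  qed
  \<comment> \<open>The last step of \<open>de\<close> is the inverted first letter of
    \<open>p1\<close>, its first step the inverted last letter. So a cancelling pair of letters
    splits off at the front or at the back.\<close>
  then show False
  proof
    assume "al 1 = de n - de (n - 1)"
    then have "vec (p0 ! 0) = - vec (p1 ! 0)"
      using al_step[of 0] de_step[of "n - 1"] pos by (simp add: al_def)
    moreover obtain x y p q where pq: "p0 = x # p" "p1 = y # q" using ne by (meson neq_Nil_conv)
    ultimately have y: "y = inv_letter x" and xy: "vec x + vec y = 0" by (simp_all add: vec_eq_uminus)
    have "disp p + disp q = 0" using zero xy
      by (simp add: pq prod_eq_iff)
    then have "derivable p q" by (intro IH) (simp_all add: pq)
    from concat[OF derivable_letters[of x] this] not show False by (simp add: pq y)
  next
    assume "al m - al (m - 1) = de 1"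
    then have "vec (p0 ! (m - 1)) = - vec (p1 ! (n - 1))"
      using al_step[of "m - 1"] de_step[of 0] pos by (simp add: de_def n_def)
    moreover obtain x y p q where pq: "p0 = p @ [x]" "p1 = q @ [y]" using ne by (meson rev_exhaust)
    ultimately have y: "y = inv_letter x" and xy: "vec x + vec y = 0"
      by (simp_all add: m_def n_def vec_eq_uminus)
    have "disp p + disp q = 0" using zero xy
      by (simp add: pq prod_eq_iff)
    then have "derivable p q" by (intro IH) (simp_all add: pq)
    from concat[OF this derivable_letters[of x]] not show False by (simp add: pq y)
  qed
qed

lemma derivable_of_disp: "disp p0 + disp p1 = 0 \<Longrightarrow> derivable p0 p1"
proof (induction "length p0 + length p1" arbitrary: p0 p1 rule: less_induct)
  case less
  \<comment> \<open>Moving letters from one word to an empty partner keeps the total length, so the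
    induction hypothesis would not cover the resulting pair.\<close>
  have both: "derivable p q"
    if "length p + length q = length p0 + length p1" "p \<noteq> []" "q \<noteq> []" "disp p + disp q = 0" for p q
    by (rule derivable_step[OF less(1)]) (simp_all add: that)
  have nil: "derivable [] []" using axiom[of "[]"] by (simp add: bar_def)
  \<comment> \<open>At least two letters are present, so splitting off the first one leaves two
    nonempty words for \<open>both\<close>.\<close>
  have long: "\<exists>y z. w = y # z \<and> z \<noteq> []" if ne: "w \<noteq> []" and zero: "disp w = 0" for w
  proof -
    obtain y z where w: "w = y # z" using ne by (cases w) auto
    have "vec y \<noteq> 0" using zero_notin_units vec_in_units[of y] by metis
    then have "z \<noteq> []" using zero by (auto simp: w)
    then show ?thesis using w by blast
  qed
  consider "p0 = []" "p1 = []" | "p0 = []" "p1 \<noteq> []" | "p0 \<noteq> []" "p1 = []" | "p0 \<noteq> []" "p1 \<noteq> []"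
    by blast
  then show ?case
  proof cases
    case 1
    then show ?thesis using nil by simp
  next
    case 2
    then obtain x q where q: "p1 = x # q" "q \<noteq> []" using long[of p1] less.prems by auto
    have "derivable [x] q" by (rule both) (use 2 q less.prems in auto)
    from wrap_right[OF nil this] show ?thesis using 2 q by simp
  next
    case 3
    then obtain x q where q: "p0 = x # q" "q \<noteq> []" using long[of p0] less.prems by auto
    have "derivable [x] q" by (rule both) (use 3 q less.prems in auto)
    from wrap_left[OF this nil] show ?thesis using 3 q by simp
  next
    case 4
    then show ?thesis using less.prems by (intro both) auto
  qed
qed

theorem theorem1:
  fixes p0 p1 :: word
  assumes "p0 @ p1 \<in> O2"
  shows "derivable p0 p1"
  using assms by (intro derivable_of_disp) (simp add: O2_iff_disp)

end
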